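(* For $n\ge1$ let $\mathcal{R}_n$ be the Fibonacci-run graph. Then the generating function $$GF(u,d;t)=\sum_{n\ge1}t^n\sum_{v\in V(\mathcal{R}_n)}u^{\deg_{up}(v)}d^{\deg_{down}(v)}$$ equals $N_{u,d}/D_{u,d}$, where $$\begin{aligned}N_{u,d}={}&(d+u)t-d(u-2)t^2+(d^2-d-2u)t^3-(d-2)d(u-2)t^4\\&-(d-1)(u-d+du)t^5-d(d+u-2)t^6+d(1-2d+2d^2+du-2d^2u)t^7\\&-2(d-1)d^2(u-1)t^8-(d-1)d^2(d+1)(u-1)t^9-(d-1)^2d^2(u-1)t^{10}\\&-(d-1)^2d^2(u-1)t^{11}\end{aligned}$$ and $$\begin{aligned}D_{u,d}={}&1-ut-2t^2+(2u-d)t^3+t^4+(2d-d^2-u)t^5+d(du-1)t^7\\&+2(d-1)d^2(u-1)t^9+(d-1)^2d^2(u-1)t^{11}.\end{aligned}$$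
   Context: A binary string is run-constrained if every run of 1s in it is immediately followed by a run of 0s of strictly greater length (the empty string counts as run-constrained). For $n\ge1$ the Fibonacci-run graph $\mathcal{R}_n$ has vertex set $\{w\in\{0,1\}^n : w00 \text{ is run-constrained}\}$, two vertices being adjacent iff they differ in exactly one coordinate. For $v\in V(\mathcal{R}_n)$, $\deg_{up}(v)$ is the number of vertices of $\mathcal{R}_n$ obtained from $v$ by changing a single 0 into a 1, and $\deg_{down}(v)$ is the number of vertices of $\mathcal{R}_n$ obtained from $v$ by changing a single 1 into a 0. $u,d,t$ are indeterminates and the identity is one of formal power series in $t$. *)

theory Defs
  imports "HOL-Computational_Algebra.Computational_Algebra"
begin

text \<open>Binary strings are lists of type \<^typ>\<open>bool list\<close>, with \<^const>\<open>True\<close> for 1 and \<^const>\<open>False\<close> for 0.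
  A run is a maximal block of equal letters; the conditions on the neighbouring letters
  below express maximality.\<close>

definition run_constrained :: "bool list \<Rightarrow> bool" where
  "run_constrained w \<longleftrightarrow>
     (\<forall>xs k ys. w = xs @ replicate k True @ ys \<and> k \<ge> 1
          \<and> (xs = [] \<or> last xs = False) \<and> (ys = [] \<or> hd ys = False) \<longrightarrow>
        (\<exists>m zs. ys = replicate m False @ zs \<and> (zs = [] \<or> hd zs = True) \<and> m > k))"

definition fibrun_verts :: "nat \<Rightarrow> bool list set" where
  "fibrun_verts n = {w. length w = n \<and> run_constrained (w @ [False, False])}"

definition deg_up :: "nat \<Rightarrow> bool list \<Rightarrow> nat" where
  "deg_up n v = card {w \<in> fibrun_verts n. \<exists>i < length v. v ! i = False \<and> w = v[i := True]}"

definition deg_down :: "nat \<Rightarrow> bool list \<Rightarrow> nat" where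
  "deg_down n v = card {w \<in> fibrun_verts n. \<exists>i < length v. v ! i = True \<and> w = v[i := False]}"

definition fibrun_gf :: "'a::comm_ring_1 \<Rightarrow> 'a \<Rightarrow> 'a fps" where
  "fibrun_gf u d =
     Abs_fps (\<lambda>n. if n \<ge> 1 then \<Sum>v\<in>fibrun_verts n. u ^ deg_up n v * d ^ deg_down n v else 0)"

text \<open>The field of rational functions \<open>\<rat>(u, d)\<close>, as the field of fractions of \<open>\<int>[u][d]\<close>.\<close>

type_synonym ratfun_ud = "int poly poly fract"

definition indet_u :: ratfun_ud where
  "indet_u = Fract [:[:0, 1:]:] 1"

definition indet_d :: ratfun_ud where
  "indet_d = Fract [:0, 1:] 1"

end

theory Submission
  imports Defs
begin

text \<open>
  The run-constrained words form the free monoid on the code words \<open>1\<^sup>k 0\<^sup>k\<^sup>+\<^sup>1\<close> with \<open>k \<ge> 0\<close>, and every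
  such word of length at least 2 ends in 00. Hence the vertices of \<open>R\<^sub>n\<close> correspond to sequences
  \<open>k\<^sub>1, k\<^sub>2, \<dots>\<close> of naturals with \<open>\<Sum> (2 k\<^sub>i + 1) = n + 2\<close>. In these terms, changing a 0 into a 1
  replaces three consecutive entries \<open>k, 0, 0\<close> or \<open>0, k, 0\<close> by \<open>k + 1\<close>. So the up-degree counts
  the consecutive triples \<open>x, y, z\<close> with \<open>z = 0\<close> and \<open>x = 0 \<or> y = 0\<close>, and the down-degree is
  \<open>\<Sum> min k\<^sub>i 2\<close>. A transfer system whose state records which of the last two entries vanish
  then determines the generating function.
\<close>

section \<open>Code words and unique readability\<close>

definition runblock :: "nat \<Rightarrow> bool list" where
  "runblock k = replicate k True @ replicate (Suc k) False"

definition decode :: "nat list \<Rightarrow> bool list" where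
  "decode ks = concat (map runblock ks)"

lemma decode_simps [simp]:
  "decode [] = []" "decode (k # ks) = runblock k @ decode ks"
  by (simp_all add: decode_def)

lemma length_runblock [simp]: "length (runblock k) = 2 * k + 1"
  by (simp add: runblock_def)

lemma runblock_neq_Nil [simp]: "runblock k \<noteq> []"
  by (simp add: runblock_def)

lemma runblock_0: "runblock 0 = [False]"
  by (simp add: runblock_def)

lemma last_runblock [simp]: "last (runblock k) = False"
  by (simp add: runblock_def)

lemma nth_runblock: "i < 2 * k + 1 \<Longrightarrow> runblock k ! i \<longleftrightarrow> i < k"
  by (auto simp: runblock_def nth_append nth_Cons')

lemma replicate_True_append_eqD:
  assumes "replicate j True @ False # x = replicate k True @ False # y"
  shows "j = k \<and> x = y"
  using assms
proof (induction j arbitrary: k)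
  case 0
  then show ?case by (cases k) auto
next
  case (Suc j)
  then show ?case by (cases k) auto
qed

lemma runblock_append_eq:
  "runblock k @ y = replicate k True @ False # replicate k False @ y"
  by (simp add: runblock_def)

text \<open>The number of 1s before the first zero is the first entry. This unique readability gives
  injectivity of \<open>decode\<close> and parses flipped words.\<close>

lemma decode_eq_ones_zero_appendD:
  assumes "decode s = replicate k True @ False # y"
  shows "\<exists>s'. s = k # s' \<and> y = replicate k False @ decode s'"
proof (cases s)
  case (Cons c t)
  then show ?thesis
    using assms replicate_True_append_eqD[of c "replicate c False @ decode t" k y]
    by (auto simp: runblock_append_eq)
qed (use assms in auto)

lemma decode_eq_runblock_appendD:
  assumes "decode s = runblock c @ y"
  shows "\<exists>s'. s = c # s' \<and> decode s' = y"
  using decode_eq_ones_zero_appendD[of s c "replicate c False @ y"] assms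
  by (auto simp: runblock_append_eq)

lemma decode_inject: "decode s = decode t \<Longrightarrow> s = t"
proof (induction t arbitrary: s)
  case Nil
  then show ?case by (cases s) auto
next
  case (Cons c t)
  then show ?case using decode_eq_runblock_appendD[of s c "decode t"] by auto
qed

lemma inj_decode: "inj decode"
  by (auto intro: injI decode_inject)

section \<open>Run-constrained words as products of code words\<close>

lemma run_constrained_Nil: "run_constrained []"
  by (simp add: run_constrained_def)

lemma run_constrained_appendD:
  assumes "run_constrained (p @ w)" "p \<noteq> []" "last p = False"
  shows "run_constrained w"
  unfolding run_constrained_def
proof (intro allI impI)
  fix xs k ys
  assume A: "w = xs @ replicate k True @ ys \<and> 1 \<le> k \<and> (xs = [] \<or> last xs = False) \<and> (ys = [] \<or> hd ys = False)"
  then have "p @ w = (p @ xs) @ replicate k True @ ys" "last (p @ xs) = False"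
    using assms(3) by (auto simp: last_append)
  then show "\<exists>m zs. ys = replicate m False @ zs \<and> (zs = [] \<or> hd zs = True) \<and> m > k"
    using assms(1) A unfolding run_constrained_def by blast
qed

lemma leading_zeros_split:
  "\<exists>m zs. w = replicate m False @ zs \<and> (zs = [] \<or> hd zs = True)"
proof (induction w)
  case (Cons a w)
  then obtain m zs where "w = replicate m False @ zs" "zs = [] \<or> hd zs = True" by blast
  then show ?case
    by (cases a; force intro: exI[of _ 0] exI[of _ "Suc m"])
qed auto

text \<open>A block ends in 0, so no run of 1s straddles the boundary: it is either the run opening
  the block, whose zeros the leading zeros of \<open>w\<close> can only lengthen, or a run of
  \<open>w\<close>.\<close>

lemma run_constrained_runblock_append:
  assumes "run_constrained w"
  shows "run_constrained (runblock c @ w)"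
  unfolding run_constrained_def
proof (intro allI impI, elim conjE)
  fix xs k ys
  assume eq: "runblock c @ w = xs @ replicate k True @ ys" and k: "1 \<le> k"
    and xs: "xs = [] \<or> last xs = False" and ys: "ys = [] \<or> hd ys = False"
  show "\<exists>m zs. ys = replicate m False @ zs \<and> (zs = [] \<or> hd zs = True) \<and> m > k"
  proof (cases "xs = []")
    case True
    have "ys \<noteq> []"
    proof
      assume "ys = []"
      with eq True have "runblock c @ w = replicate k True" by simp
      then have "set (runblock c @ w) \<subseteq> {True}" by (metis set_replicate_conv_if subset_refl empty_subsetI)
      then show False by (auto simp: runblock_def)
    qed
    with ys obtain ys' where ys': "ys = False # ys'" by (cases ys) auto
    with True eq have *: "c = k" "replicate c False @ w = ys'"
      using replicate_True_append_eqD[of c "replicate c False @ w" k ys']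
      by (simp_all add: runblock_append_eq)
    obtain m zs where m: "w = replicate m False @ zs" "zs = [] \<or> hd zs = True"
      using leading_zeros_split by blast
    have "ys = replicate (Suc k + m) False @ zs"
      using * ys' m by (simp add: replicate_add)
    then show ?thesis using m(2) by (intro exI[of _ "Suc k + m"] exI[of _ zs]) auto
  next
    case False
    then have l: "last xs = False" using xs by simp
    \<comment> \<open>A run starting inside the block would start among the block's 1s; the letter
      before it would then also be a 1, against maximality.\<close>
    have len: "length xs \<ge> 2 * c + 1"
    proof (rule ccontr)
      assume a: "\<not> ?thesis"
      have "(runblock c @ w) ! length xs" using k by (simp add: eq nth_append)
      with a have "length xs < c" by (simp add: nth_append nth_runblock)
      moreover have "\<not> (runblock c @ w) ! (length xs - 1)"
        using False l by (simp add: eq nth_append last_conv_nth)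
      moreover have "length xs - 1 < c" "length xs - 1 < 2 * c + 1"
        using \<open>length xs < c\<close> by auto
      ultimately show False
        by (simp add: nth_append nth_runblock del: One_nat_def)
    qed
    then have "take (2 * c + 1) xs = runblock c"
      using arg_cong[OF eq, of "take (2 * c + 1)"] by simp
    then obtain xs' where xs': "xs = runblock c @ xs'"
      by (metis append_take_drop_id)
    with eq have "w = xs' @ replicate k True @ ys" by simp
    moreover have "xs' = [] \<or> last xs' = False" using l xs' by auto
    ultimately show ?thesis using assms k ys unfolding run_constrained_def by blast
  qed
qed

lemma run_constrained_decode: "run_constrained (decode ks)"
  by (induction ks) (simp_all add: run_constrained_Nil run_constrained_runblock_append)

text \<open>More than \<open>c\<close> zeros follow \<open>c > 0\<close> leading 1s. The first
  \<open>Suc c\<close> of them close the block; surplus zeros stay in the remainder, where each can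
  serve as a block of its own.\<close>

lemma run_constrained_split_runblock:
  assumes "run_constrained w" "w \<noteq> []"
  shows "\<exists>c w'. w = runblock c @ w'"
proof -
  define c where "c = length (takeWhile id w)"
  define ys where "ys = dropWhile id w"
  have "takeWhile id w = replicate c True"
    unfolding c_def by (rule replicate_length_same[symmetric]) (auto dest: set_takeWhileD)
  then have w: "w = replicate c True @ ys"
    unfolding ys_def by (metis takeWhile_dropWhile_id)
  have ys: "ys = [] \<or> hd ys = False"
    unfolding ys_def using hd_dropWhile[of id w] by auto
  show ?thesis
  proof (cases "c = 0")
    case True
    then have "w = runblock 0 @ tl w" using w ys assms(2) by (cases w) (auto simp: runblock_0)
    then show ?thesis by blast
  next
    case False
    then have "\<exists>m zs. ys = replicate m False @ zs \<and> (zs = [] \<or> hd zs = True) \<and> m > c"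
      using assms(1)[unfolded run_constrained_def, rule_format, of "[]" c ys] w ys by auto
    then obtain m zs where "ys = replicate m False @ zs" "m > c" by blast
    moreover from \<open>m > c\<close> have "replicate m False = replicate (Suc c) False @ replicate (m - Suc c) False"
      by (simp only: replicate_add[symmetric]) simp
    ultimately have "w = runblock c @ replicate (m - Suc c) False @ zs"
      using w by (simp add: runblock_def)
    then show ?thesis by blast
  qed
qed

lemma run_constrained_iff_decode: "run_constrained w \<longleftrightarrow> w \<in> range decode"
proof
  show "run_constrained w \<Longrightarrow> w \<in> range decode"
  proof (induction w rule: length_induct)
    case (1 w)
    show ?case
    proof (cases "w = []")
      case True
      then show ?thesis by (metis decode_simps(1) rangeI)
    next
      case False
      then obtain c w' where w: "w = runblock c @ w'"
        using run_constrained_split_runblock 1 by blast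
      then have "run_constrained w'"
        using 1(2) run_constrained_appendD by auto
      moreover have "length w' < length w" using w by simp
      ultimately obtain s where "w' = decode s" using 1(1) by blast
      then show ?thesis using w by (metis decode_simps(2) rangeI)
    qed
  qed
qed (use run_constrained_decode in blast)

text \<open>A last entry \<open>k > 0\<close> contributes at least two zeros; a last entry 0
  contributes one, preceded by the final zero of the previous block. Hence the padding 00 can be
  stripped without loss.\<close>

lemma decode_ends_zeros:
  assumes "length (decode ks) \<ge> 2"
  shows "\<exists>w. decode ks = w @ [False, False]"
proof (cases ks rule: rev_cases)
  case (snoc s k)
  have d: "decode ks = decode s @ runblock k" using snoc by (simp add: decode_def)
  show ?thesis
  proof (cases k)
    case 0
    then have "s \<noteq> []" using assms d by auto
    then obtain s' j where "s = s' @ [j]" by (metis rev_exhaust)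
    then have "decode s = decode s' @ replicate j True @ replicate j False @ [False]"
      by (simp add: decode_def runblock_def replicate_append_same)
    then show ?thesis using d 0 by (auto simp: runblock_0)
  next
    case (Suc j)
    then have "runblock k = replicate k True @ replicate j False @ [False, False]"
      by (simp add: runblock_def replicate_append_same)
         (simp flip: replicate_append_same)
    then show ?thesis using d by simp
  qed
qed (use assms in auto)

section \<open>Single flips on sequences\<close>

text \<open>\<open>covers s s'\<close> means that \<open>decode s'\<close> arises from \<open>decode s\<close> by changing one 0 into a 1.\<close>

inductive covers :: "nat list \<Rightarrow> nat list \<Rightarrow> bool" where
  covers_left: "covers (k # 0 # 0 # s) (Suc k # s)"
| covers_right: "covers (0 # k # 0 # s) (Suc k # s)"
| covers_Cons: "covers s s' \<Longrightarrow> covers (c # s) (c # s')"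

text \<open>The block of \<open>Suc k\<close> is k+1 ones followed by k+2 zeros. Clearing its last 1
  leaves the blocks of \<open>k, 0, 0\<close>; clearing its first 1 leaves those of
  \<open>0, k, 0\<close>.\<close>

lemma covers_imp_flip:
  assumes "covers s s'"
  shows "\<exists>p q. decode s = p @ False # q \<and> decode s' = p @ True # q"
  using assms
proof induction
  case (covers_left k s)
  show ?case
    by (intro exI[of _ "replicate k True"] exI[of _ "replicate (k+2) False @ decode s"])
       (simp add: runblock_def replicate_app_Cons_same)
next
  case (covers_right k s)
  show ?case
    by (intro exI[of _ "[]"] exI[of _ "replicate k True @ replicate (k+2) False @ decode s"])
       (simp add: runblock_def replicate_app_Cons_same)
next
  case (covers_Cons s s' c)
  then obtain p q where "decode s = p @ False # q" "decode s' = p @ True # q" by blast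
  then show ?case by (intro exI[of _ "runblock c @ p"] exI[of _ q]) simp
qed

text \<open>Only the first and the last 1 of a block can be cleared: clearing an inner one would
  leave a run of 1s followed by a single zero.\<close>

lemma flip_imp_covers:
  assumes "decode s = p @ False # q" "decode s' = p @ True # q"
  shows "covers s s'"
  using assms
proof (induction s' arbitrary: s p)
  case (Cons c t)
  show ?case
  proof (cases "length p \<ge> 2 * c + 1")
    case True
    then have "take (2 * c + 1) p = runblock c"
      using arg_cong[OF Cons.prems(2), of "take (2 * c + 1)"] by simp
    then obtain p' where p': "p = runblock c @ p'"
      by (metis append_take_drop_id)
    then obtain s1 where "s = c # s1" "decode s1 = p' @ False # q"
      using decode_eq_runblock_appendD[of s c "p' @ False # q"] Cons.prems(1) by auto
    then show ?thesis using Cons.IH[of s1 p'] Cons.prems(2) p' by (auto intro: covers_Cons)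
  next
    case False
    define j where "j = length p"
    have "decode (c # t) ! j" unfolding Cons.prems(2) j_def by simp
    with False have jc: "j < c" by (simp add: nth_append nth_runblock j_def)
    then obtain i where c: "c = j + Suc i" by (metis less_iff_Suc_add add_Suc_right)
    have "p @ True # q = replicate j True @ True # replicate i True @ replicate (Suc c) False @ decode t"
      using Cons.prems(2) by (simp add: runblock_def c replicate_add replicate_app_Cons_same)
    then have p: "p = replicate j True" and q: "q = replicate i True @ replicate (Suc c) False @ decode t"
      by (auto simp: j_def append_eq_append_conv)
    obtain s1 where s1: "s = j # s1" "q = replicate j False @ decode s1"
      using decode_eq_ones_zero_appendD[of s j q] Cons.prems(1) p by blast
    show ?thesis
    proof (cases "j = 0")
      case True
      then have "decode s1 = decode (i # 0 # t)"
        using s1 q c by (simp add: runblock_def replicate_app_Cons_same)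
      then show ?thesis using decode_inject s1 True c covers_right by fastforce
    next
      case j: False
      then have "i = 0" using s1(2) q by (cases i; cases j) auto
      then have "replicate j False @ decode s1 = replicate j False @ decode (0 # 0 # t)"
        using s1(2) q c by (simp add: runblock_def replicate_app_Cons_same)
      then have "s1 = 0 # 0 # t" using decode_inject by blast
      then show ?thesis using s1 c \<open>i = 0\<close> covers_left by auto
    qed
  qed
qed auto

lemma covers_iff_flip:
  "covers s s' \<longleftrightarrow> (\<exists>p q. decode s = p @ False # q \<and> decode s' = p @ True # q)"
  using covers_imp_flip flip_imp_covers by blast

section \<open>Degrees as statistics of sequences\<close>

fun up_triples :: "nat list \<Rightarrow> nat" where
  "up_triples (x # y # z # s) = (if z = 0 \<and> (x = 0 \<or> y = 0) then 1 else 0) + up_triples (y # z # s)"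
| "up_triples _ = 0"

definition down_moves :: "nat list \<Rightarrow> nat" where
  "down_moves ks = (\<Sum>k\<leftarrow>ks. min k 2)"

lemma covers_Nil: "\<not> covers [] s" "\<not> covers s []"
  by (auto elim: covers.cases)

text \<open>Both head rules yield \<open>Suc (x + y) # s\<close>, because one of \<open>x\<close>,
  \<open>y\<close> is 0, so a qualifying triple gives one cover even for \<open>0, 0, 0\<close>. Its
  larger head separates it from covers in the tail.\<close>

lemma finite_card_upper_covers:
  "finite {s'. covers s s'} \<and> card {s'. covers s s'} = up_triples s"
proof (induction s rule: up_triples.induct)
  case (1 x y z s)
  let ?U = "(#) x ` {s'. covers (y # z # s) s'}"
  let ?V = "if z = 0 \<and> (x = 0 \<or> y = 0) then {Suc (x + y) # s} else {}"
  have eq: "{s'. covers (x # y # z # s) s'} = ?U \<union> ?V"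
    by (auto elim: covers.cases intro: covers.intros)
  have "?U \<inter> ?V = {}" by auto
  then show ?case using 1 unfolding eq
    by (subst card_Un_disjoint) (auto simp: card_image)
next
  case ("2_3" x y)
  have "{s'. covers [x, y] s'} = {}"
    by (auto elim!: covers.cases[of "[x, y]"] covers.cases[of "[y]"] simp: covers_Nil)
  then show ?case by simp
next
  case ("2_2" x)
  have "{s'. covers [x] s'} = {}"
    by (auto elim!: covers.cases[of "[x]"] simp: covers_Nil)
  then show ?case by simp
qed (auto simp: covers_Nil)

text \<open>A positive entry \<open>c\<close> comes from \<open>c - 1, 0, 0\<close> and from
  \<open>0, c - 1, 0\<close>, which coincide exactly when \<open>c = 1\<close>; hence
  \<open>min c 2\<close>.\<close>

lemma finite_card_lower_covers:
  "finite {s. covers s s'} \<and> card {s. covers s s'} = down_moves s'"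
proof (induction s')
  case (Cons c t)
  let ?U = "(#) c ` {s. covers s t}"
  let ?V = "if c = 0 then {} else {(c - 1) # 0 # 0 # t, 0 # (c - 1) # 0 # t}"
  have eq: "{s. covers s (c # t)} = ?U \<union> ?V"
    by (auto elim: covers.cases intro: covers.intros simp: gr0_conv_Suc)
  have "?U \<inter> ?V = {}" by auto
  moreover have "card ?V = min c 2" by (auto simp: card_insert_if min_def)
  ultimately show ?case using Cons unfolding eq
    by (subst card_Un_disjoint) (auto simp: card_image down_moves_def)
qed (auto simp: covers_Nil down_moves_def)

section \<open>Transfer to the vertices of the graph\<close>

lemma list_update_eq_iff_split:
  "(\<exists>i<length v. v ! i = a \<and> w = v[i := b]) \<longleftrightarrow> (\<exists>p q. v = p @ a # q \<and> w = p @ b # q)"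
proof
  assume "\<exists>i<length v. v ! i = a \<and> w = v[i := b]"
  then obtain i where "i < length v" "v ! i = a" "w = v[i := b]" by blast
  then have "v = take i v @ a # drop (Suc i) v" "w = take i v @ b # drop (Suc i) v"
    by (auto simp: id_take_nth_drop[symmetric] upd_conv_take_nth_drop)
  then show "\<exists>p q. v = p @ a # q \<and> w = p @ b # q" by blast
next
  assume "\<exists>p q. v = p @ a # q \<and> w = p @ b # q"
  then obtain p q where "v = p @ a # q" "w = p @ b # q" by blast
  then show "\<exists>i<length v. v ! i = a \<and> w = v[i := b]"
    by (intro exI[of _ "length p"]) simp
qed

text \<open>The flipped position cannot lie in the common suffix \<open>z\<close>, where the words
  agree. With \<open>z\<close> the padding 00, flips of padded words are flips of vertices.\<close>

lemma split_flip_append_iff: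
  assumes "a \<noteq> b"
  shows "(\<exists>p q. v @ z = p @ a # q \<and> w @ z = p @ b # q) \<longleftrightarrow> (\<exists>p q. v = p @ a # q \<and> w = p @ b # q)"
proof
  assume "\<exists>p q. v @ z = p @ a # q \<and> w @ z = p @ b # q"
  then obtain p q where pq: "v @ z = p @ a # q" "w @ z = p @ b # q" by blast
  have len: "length v = length w"
    using arg_cong[OF pq(1), of length] arg_cong[OF pq(2), of length] by simp
  have "length p < length v"
  proof (rule ccontr)
    assume "\<not> ?thesis"
    then have "(v @ z) ! length p = (w @ z) ! length p"
      using len by (simp add: nth_append)
    then show False using assms unfolding pq by simp
  qed
  then obtain r where "v = p @ r" "r \<noteq> []" "r @ z = a # q"
    using pq(1) by (auto simp: append_eq_append_conv2)
  then obtain q' where "v = p @ a # q'" "q = q' @ z"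
    by (cases r) auto
  then show "\<exists>p q. v = p @ a # q \<and> w = p @ b # q"
    using pq(2) by auto
qed (metis append.assoc append_Cons)

definition codes :: "nat \<Rightarrow> nat list set" where
  "codes n = {ks. length (decode ks) = n}"

lemma finite_codes [simp]: "finite (codes n)"
proof -
  have "codes n = decode -` {w. set w \<subseteq> UNIV \<and> length w = n}"
    by (auto simp: codes_def)
  then show ?thesis
    using finite_vimageI[OF finite_lists_length_eq[OF finite_UNIV] inj_decode] by simp
qed

lemma decode_codes:
  assumes "ks \<in> codes (n + 2)"
  shows "take n (decode ks) @ [False, False] = decode ks"
  using decode_ends_zeros[of ks] assms by (auto simp: codes_def)

text \<open>A flip keeps the length, so a cover of a vertex code is again a vertex code: the cover
  counts over all lists are already the degrees.\<close>

lemma covers_codes: "covers s s' \<Longrightarrow> s \<in> codes n \<longleftrightarrow> s' \<in> codes n"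
  using covers_imp_flip[of s s'] by (auto simp: codes_def)

lemma bij_betw_codes_fibrun_verts:
  "bij_betw (\<lambda>ks. take n (decode ks)) (codes (n + 2)) (fibrun_verts n)"
  unfolding bij_betw_def
proof
  show "inj_on (\<lambda>ks. take n (decode ks)) (codes (n + 2))"
  proof (rule inj_onI)
    fix s s'
    assume "s \<in> codes (n + 2)" "s' \<in> codes (n + 2)" and eq: "take n (decode s) = take n (decode s')"
    then have "decode s = decode s'"
      using decode_codes[of s n] decode_codes[of s' n] by metis
    then show "s = s'" by (rule decode_inject)
  qed
  show "(\<lambda>ks. take n (decode ks)) ` codes (n + 2) = fibrun_verts n"
  proof (intro equalityI subsetI)
    fix w assume "w \<in> (\<lambda>ks. take n (decode ks)) ` codes (n + 2)"
    then obtain ks where "ks \<in> codes (n + 2)" "w = take n (decode ks)" by blast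
    then show "w \<in> fibrun_verts n"
      using decode_codes[of ks n] run_constrained_decode[of ks]
      by (simp add: fibrun_verts_def codes_def)
  next
    fix w assume "w \<in> fibrun_verts n"
    then obtain ks where "decode ks = w @ [False, False]" "length w = n"
      by (auto simp: fibrun_verts_def run_constrained_iff_decode)
    then show "w \<in> (\<lambda>ks. take n (decode ks)) ` codes (n + 2)"
      by (intro image_eqI[of _ _ ks]) (auto simp: codes_def)
  qed
qed

lemma covers_iff_flip_take:
  assumes "s \<in> codes (n + 2)" "s' \<in> codes (n + 2)"
  shows "covers s s' \<longleftrightarrow>
    (\<exists>p q. take n (decode s) = p @ False # q \<and> take n (decode s') = p @ True # q)"
  using split_flip_append_iff[of False True "take n (decode s)" "[False, False]" "take n (decode s')"]
  by (simp only: covers_iff_flip decode_codes[OF assms(1)] decode_codes[OF assms(2)]) simp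

lemma deg_up_codes:
  assumes "s \<in> codes (n + 2)"
  shows "deg_up n (take n (decode s)) = up_triples s"
proof -
  let ?f = "\<lambda>ks. take n (decode ks)"
  have "{w \<in> fibrun_verts n. \<exists>i<length (?f s). ?f s ! i = False \<and> w = (?f s)[i := True]}
      = ?f ` {s'. covers s s'}"
    unfolding list_update_eq_iff_split bij_betw_imp_surj_on[OF bij_betw_codes_fibrun_verts, symmetric]
    using covers_iff_flip_take[OF assms] covers_codes[of s _ "n + 2"] assms by auto
  moreover have "inj_on ?f {s'. covers s s'}"
    by (rule inj_on_subset[OF bij_betw_imp_inj_on[OF bij_betw_codes_fibrun_verts]])
       (use covers_codes assms in auto)
  ultimately show ?thesis
    by (simp add: deg_up_def card_image finite_card_upper_covers)
qed

lemma deg_down_codes: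
  assumes "s \<in> codes (n + 2)"
  shows "deg_down n (take n (decode s)) = down_moves s"
proof -
  let ?f = "\<lambda>ks. take n (decode ks)"
  have "{w \<in> fibrun_verts n. \<exists>i<length (?f s). ?f s ! i = True \<and> w = (?f s)[i := False]}
      = ?f ` {s'. covers s' s}"
    unfolding list_update_eq_iff_split bij_betw_imp_surj_on[OF bij_betw_codes_fibrun_verts, symmetric]
    using covers_iff_flip_take[OF _ assms] covers_codes[of _ s "n + 2"] assms by (auto, metis)
  moreover have "inj_on ?f {s'. covers s' s}"
    by (rule inj_on_subset[OF bij_betw_imp_inj_on[OF bij_betw_codes_fibrun_verts]])
       (use covers_codes assms in auto)
  ultimately show ?thesis
    by (simp add: deg_down_def card_image finite_card_lower_covers)
qed

section \<open>Generating functions and transfer recursions\<close>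

definition code_gf :: "(nat list \<Rightarrow> 'a::comm_ring_1) \<Rightarrow> 'a fps" where
  "code_gf f = Abs_fps (\<lambda>n. \<Sum>s\<in>codes n. f s)"

text \<open>The coefficient of \<open>t\<^sup>n\<close> for \<open>n = 2 k + 1\<close>, \<open>k \<ge> 1\<close>, is the down-weight of the entry \<open>k\<close>.\<close>

definition block_gf :: "'a::comm_ring_1 \<Rightarrow> 'a fps" where
  "block_gf d = Abs_fps (\<lambda>n. if odd n \<and> n \<ge> 3 then d ^ min (n div 2) 2 else 0)"

text \<open>From length 5 on all odd coefficients are \<open>d ^ 2\<close>, so multiplication by
  \<open>1 - fps_X ^ 2\<close> telescopes and leaves a polynomial.\<close>

lemma block_gf_mult:
  "block_gf d * (1 - fps_X ^ 2) = fps_const d * fps_X ^ 3 + fps_const (d\<^sup>2 - d) * fps_X ^ 5"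
proof (rule fps_ext)
  fix n :: nat
  show "fps_nth (block_gf d * (1 - fps_X ^ 2)) n
      = fps_nth (fps_const d * fps_X ^ 3 + fps_const (d\<^sup>2 - d) * fps_X ^ 5) n"
  proof (cases "n \<ge> 7")
    case True
    then have "min (n div 2) 2 = 2" "min ((n - 2) div 2) 2 = 2" by linarith+
    then show ?thesis using True
      by (simp add: right_diff_distrib fps_X_power_mult_right_nth block_gf_def)
  next
    case False
    then have "n = 0 \<or> n = 1 \<or> n = 2 \<or> n = 3 \<or> n = 4 \<or> n = 5 \<or> n = 6" by linarith
    then show ?thesis
      by (elim disjE) (simp_all add: right_diff_distrib fps_X_power_mult_right_nth block_gf_def)
  qed
qed

text \<open>The three summands stem from the empty list, a leading 0 and a positive first entry. The
  last is a convolution because the factor \<open>h\<close> does not depend on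
  \<open>k\<close>.\<close>

lemma code_gf_rec:
  assumes "f [] = 1" "\<And>s. f (0 # s) = a * g s"
    "\<And>k s. f (Suc k # s) = d ^ min (Suc k) 2 * h s"
  shows "code_gf f = 1 + fps_const a * fps_X * code_gf g + block_gf d * code_gf h"
proof (rule fps_ext)
  fix n :: nat
  let ?A = "if n = 0 then {[] :: nat list} else {}"
  let ?B = "if n = 0 then {} else (#) 0 ` codes (n - 1)"
  let ?C = "{s \<in> codes n. s \<noteq> [] \<and> hd s \<noteq> 0}"
  let ?I = "{i\<in>{0..n}. odd i \<and> i \<ge> 3}"
  have codes: "codes n = ?A \<union> ?B \<union> ?C"
  proof (rule set_eqI)
    fix s
    show "s \<in> codes n \<longleftrightarrow> s \<in> ?A \<union> ?B \<union> ?C"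
      by (cases s) (auto simp: codes_def)
  qed
  have "sum f (codes n) = sum f (?A \<union> ?B \<union> ?C)"
    using codes by (rule arg_cong)
  also have "\<dots> = sum f (?A \<union> ?B) + sum f ?C"
    by (rule sum.union_disjoint) auto
  also have "sum f (?A \<union> ?B) = sum f ?A + sum f ?B"
    by (rule sum.union_disjoint) auto
  also have "sum f ?A = fps_nth 1 n"
    using assms(1) by simp
  also have "sum f ?B = fps_nth (fps_const a * fps_X * code_gf g) n"
    by (auto simp: sum.reindex assms(2) code_gf_def mult.assoc sum_distrib_left)
  \<comment> \<open>The first entry \<open>k\<close> is indexed by its block length
    \<open>i = 2 * k + 1\<close>, recovered by \<open>i div 2\<close>, to obtain a Cauchy
    product.\<close>
  also have "sum f ?C = (\<Sum>(i, s)\<in>Sigma ?I (\<lambda>i. codes (n - i)). d ^ min (i div 2) 2 * h s)"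
  proof (rule sum.reindex_bij_witness
      [where i = "\<lambda>(i, s). (i div 2) # s" and j = "\<lambda>s. (2 * hd s + 1, tl s)"])
    fix s assume "s \<in> ?C"
    then obtain k t where s: "s = Suc k # t"
      by (cases s) (auto simp: gr0_conv_Suc)
    then show "(case (2 * hd s + 1, tl s) of (i, s) \<Rightarrow> (i div 2) # s) = s"
      "(case (2 * hd s + 1, tl s) of (i, s) \<Rightarrow> d ^ min (i div 2) 2 * h s) = f s"
      using assms(3)[of k t] by (simp_all del: mult_Suc_right)
    show "(2 * hd s + 1, tl s) \<in> Sigma ?I (\<lambda>i. codes (n - i))"
      using \<open>s \<in> ?C\<close> s by (auto simp: codes_def)
  next
    fix b assume "b \<in> Sigma ?I (\<lambda>i. codes (n - i))"
    then obtain i s where b: "b = (i, s)" "odd i" "i \<ge> 3" "i \<le> n" "s \<in> codes (n - i)"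
      by auto
    then show "(2 * hd (case b of (i, s) \<Rightarrow> (i div 2) # s) + 1, tl (case b of (i, s) \<Rightarrow> (i div 2) # s)) = b"
      by simp
    have "2 * (i div 2) + 1 = i" using b by simp
    then show "(case b of (i, s) \<Rightarrow> (i div 2) # s) \<in> ?C"
      using b by (auto simp: codes_def)
  qed
  also have "\<dots> = (\<Sum>i\<in>?I. d ^ min (i div 2) 2 * sum h (codes (n - i)))"
    by (subst sum.Sigma[symmetric]) (auto simp: sum_distrib_left)
  also have "\<dots> = fps_nth (block_gf d * code_gf h) n"
    by (auto simp: fps_mult_nth block_gf_def code_gf_def intro!: sum.mono_neutral_cong_left split: if_splits)
  finally show "fps_nth (code_gf f) n
      = fps_nth (1 + fps_const a * fps_X * code_gf g + block_gf d * code_gf h) n"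
    by (simp add: code_gf_def)
qed

text \<open>A triple depends only on which of its entries vanish, so 1 can stand for every positive
  entry; this keeps the set of states finite.\<close>

lemma up_triples_Suc_left: "up_triples (Suc k # y # s) = up_triples (1 # y # s)"
  by (cases s) auto

lemma up_triples_Suc_mid: "up_triples (x # Suc k # s) = up_triples (x # 1 # s)"
  by (cases s) (auto simp: up_triples_Suc_left simp del: One_nat_def)

lemma down_moves_Cons: "down_moves (k # s) = min k 2 + down_moves s"
  by (simp add: down_moves_def)

lemma down_moves_Nil: "down_moves [] = 0"
  by (simp add: down_moves_def)

text \<open>The prefixed entries \<open>y\<close> and \<open>x, y\<close> enter only through the triples they take part in; their own
  length and down-weight are not counted.\<close>

definition code_gf1 :: "'a::comm_ring_1 \<Rightarrow> 'a \<Rightarrow> nat \<Rightarrow> 'a fps" where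
  "code_gf1 u d y = code_gf (\<lambda>s. u ^ up_triples (y # s) * d ^ down_moves s)"

definition code_gf2 :: "'a::comm_ring_1 \<Rightarrow> 'a \<Rightarrow> nat \<Rightarrow> nat \<Rightarrow> 'a fps" where
  "code_gf2 u d x y = code_gf (\<lambda>s. u ^ up_triples (x # y # s) * d ^ down_moves s)"

text \<open>The next entry completes a triple with \<open>x, y\<close>, earning \<open>u\<close>
  only if it is 0 and \<open>x\<close> or \<open>y\<close> is 0. Then \<open>x\<close> is forgotten,
  and a positive new entry is recorded as 1.\<close>

lemma code_gf2_rec:
  "code_gf2 u d x y = 1 + fps_const (if x = 0 \<or> y = 0 then u else 1) * fps_X * code_gf2 u d y 0
     + block_gf d * code_gf2 u d y 1"
  unfolding code_gf2_def
  by (rule code_gf_rec)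
     (auto simp: down_moves_Nil down_moves_Cons up_triples_Suc_mid power_add mult_ac simp del: One_nat_def)

text \<open>With a single predecessor the next entry completes no triple, hence the factor
  1.\<close>

lemma code_gf1_rec:
  "code_gf1 u d y = 1 + fps_const 1 * fps_X * code_gf2 u d y 0 + block_gf d * code_gf2 u d y 1"
  unfolding code_gf1_def code_gf2_def
  by (rule code_gf_rec)
     (auto simp: down_moves_Nil down_moves_Cons up_triples_Suc_mid power_add mult_ac simp del: One_nat_def)

lemma code_gf_weight_rec:
  "code_gf (\<lambda>s. u ^ up_triples s * d ^ down_moves s)
     = 1 + fps_const 1 * fps_X * code_gf1 u d 0 + block_gf d * code_gf1 u d 1"
proof -
  have "up_triples (Suc k # s) = up_triples (1 # s)" for k s
    by (cases s) (auto simp: up_triples_Suc_left simp del: One_nat_def)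
  then show ?thesis
    unfolding code_gf1_def
    by (intro code_gf_rec)
       (auto simp: down_moves_Nil down_moves_Cons power_add mult_ac simp del: One_nat_def)
qed

lemma codes_lt_3: "codes 0 = {[]}" "codes 1 = {[0]}" "codes 2 = {[0, 0]}"
proof -
  have 0: "s \<in> codes 0 \<longleftrightarrow> s = []" for s
    by (cases s) (auto simp: codes_def)
  have 1: "s \<in> codes 1 \<longleftrightarrow> s = [0]" for s
    using 0[of "tl s"] by (cases s) (auto simp: codes_def)
  have 2: "s \<in> codes 2 \<longleftrightarrow> s = [0, 0]" for s
  proof (cases s)
    case (Cons k t)
    then have "s \<in> codes 2 \<longleftrightarrow> k = 0 \<and> t \<in> codes 1"
      by (simp add: codes_def) arith
    then show ?thesis using 1 Cons by auto
  qed (auto simp: codes_def)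
  show "codes 0 = {[]}" "codes 1 = {[0]}" "codes 2 = {[0, 0]}"
    using 0 1 2 by auto
qed

text \<open>The shift by \<open>fps_X ^ 2\<close> accounts for the padding 00. Lengths 0 and 1 are
  too short to contain it, and length 2 is the padded empty string, left out of
  \<open>fibrun_gf\<close>; each has one code, of weight 1.\<close>

lemma code_gf_weight_eq_fibrun_gf:
  "code_gf (\<lambda>s. u ^ up_triples s * d ^ down_moves s)
     = 1 + fps_X + fps_X ^ 2 + fps_X ^ 2 * fibrun_gf u d"
proof (rule fps_ext)
  fix n :: nat
  let ?f = "\<lambda>s. u ^ up_triples s * d ^ down_moves s"
  consider "n = 0" | "n = 1" | "n = 2" | m where "n = m + 2" "m \<ge> 1"
  proof -
    have "n = 0 \<or> n = 1 \<or> n = 2 \<or> n = (n - 2) + 2 \<and> n - 2 \<ge> 1" by arith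
    then show thesis using that by blast
  qed
  then show "fps_nth (code_gf ?f) n = fps_nth (1 + fps_X + fps_X ^ 2 + fps_X ^ 2 * fibrun_gf u d) n"
  proof cases
    case 4
    have "(\<Sum>v\<in>fibrun_verts m. u ^ deg_up m v * d ^ deg_down m v)
        = (\<Sum>s\<in>codes (m + 2). u ^ deg_up m (take m (decode s)) * d ^ deg_down m (take m (decode s)))"
      by (rule sum.reindex_bij_betw[OF bij_betw_codes_fibrun_verts, symmetric])
    also have "\<dots> = sum ?f (codes (m + 2))"
      by (intro sum.cong) (simp_all add: deg_up_codes deg_down_codes del: add_2_eq_Suc')
    finally show ?thesis
      using 4 by (simp add: code_gf_def fibrun_gf_def fps_X_power_mult_nth fps_X_power_nth del: add_2_eq_Suc')
  qed (simp_all add: code_gf_def fibrun_gf_def fps_X_power_mult_nth codes_lt_3[simplified]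
        down_moves_def fps_X_power_nth)
qed

section \<open>Solving the transfer system\<close>

text \<open>\<open>P\<close>, \<open>Q\<close>, \<open>R\<close> are the values of
  \<open>code_gf2\<close> at the states 00, 01, 11; \<open>Y\<close> has one preceding 0, and
  \<open>S\<close> is the start. The elimination never divides; it cancels the nonzero factors
  \<open>1 - B\<close> and \<open>t\<^sup>2\<close>.\<close>

lemma transfer_system_solution:
  fixes t u d B P Q R Y S G :: "'a::idom"
  assumes P: "P = 1 + u * t * P + B * Q" and Q: "Q = 1 + u * t * P + B * R"
    and R: "R = 1 + t * P + B * R" and Y: "Y = 1 + t * P + B * Q"
    and S: "S = 1 + t * Y + B * R" and G: "S = 1 + t + t\<^sup>2 + t\<^sup>2 * G"
    and B: "B * (1 - t\<^sup>2) = d * t ^ 3 + (d\<^sup>2 - d) * t ^ 5"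
    and nz: "1 - B \<noteq> 0" "t \<noteq> 0"
  shows "G * (1 - u * t - 2 * t^2 + (2 * u - d) * t^3 + t^4
             + (2 * d - d^2 - u) * t^5 + d * (d * u - 1) * t^7
             + 2 * (d - 1) * d^2 * (u - 1) * t^9
             + (d - 1)^2 * d^2 * (u - 1) * t^11)
       = (d + u) * t - d * (u - 2) * t^2 + (d^2 - d - 2 * u) * t^3
             - (d - 2) * d * (u - 2) * t^4
             - (d - 1) * (u - d + d * u) * t^5 - d * (d + u - 2) * t^6
             + d * (1 - 2 * d + 2 * d^2 + d * u - 2 * d^2 * u) * t^7
             - 2 * (d - 1) * d^2 * (u - 1) * t^8
             - (d - 1) * d^2 * (d + 1) * (u - 1) * t^9
             - (d - 1)^2 * d^2 * (u - 1) * t^10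
             - (d - 1)^2 * d^2 * (u - 1) * t^11" (is "G * ?D = ?N")
proof -
  \<comment> \<open>the determinant of the system, up to the factor \<open>1 - B\<close> that cancels\<close>
  define \<Delta> where "\<Delta> = 1 - t * u - B + t * (u - 1) * B\<^sup>2"
  have P': "P * \<Delta> = 1"
    using P Q R unfolding \<Delta>_def by algebra
  \<comment> \<open>As \<open>(1 - B) * R = 1 + t * P\<close>, the left side is
    \<open>\<Delta> + t\<close>, which has the factor \<open>1 - B\<close>.\<close>
  have "(1 - B) * (R * \<Delta>) = (1 - B) * (1 - t * (u - 1) * (1 + B))"
    using R P' unfolding \<Delta>_def by algebra
  then have R': "R * \<Delta> = 1 - t * (u - 1) * (1 + B)"
    using nz by simp
  have Q': "Q * \<Delta> = 1 - t * (u - 1) * B"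
    using Q P' R' unfolding \<Delta>_def by algebra
  \<comment> \<open>Inserting \<open>Y\<close> into \<open>S\<close> gives \<open>t\<^sup>2 * G =
    t\<^sup>2 * P + t * B * Q + B * R - t\<^sup>2\<close>, which is then multiplied by
    \<open>\<Delta>\<close>.\<close>
  have G': "G * t\<^sup>2 * \<Delta> = - t\<^sup>2 * \<Delta> + t\<^sup>2 + B * (1 + t - t * (u - 1)) - t * (u - 1) * (1 + t) * B\<^sup>2"
    using S G Y P' Q' R' by algebra
  \<comment> \<open>\<open>\<Delta>\<close> is quadratic in \<open>B\<close>, and
    \<open>B * T\<close> is a polynomial in \<open>t\<close>, so the factor \<open>T\<^sup>2\<close>
    clears all denominators.\<close>
  define T where "T = 1 - t\<^sup>2"
  define \<beta> where "\<beta> = d * t ^ 3 + (d\<^sup>2 - d) * t ^ 5"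
  have BT: "B * T = \<beta>" using B by (simp add: T_def \<beta>_def)
  have D: "T\<^sup>2 * \<Delta> = (1 - t * u) * T\<^sup>2 - \<beta> * T + t * (u - 1) * \<beta>\<^sup>2"
    unfolding \<Delta>_def BT[symmetric] by algebra
  also have "\<dots> = ?D"
    unfolding T_def \<beta>_def by algebra
  finally have D': "T\<^sup>2 * \<Delta> = ?D" .
  have "t\<^sup>2 * (G * ?D) = T\<^sup>2 * (G * t\<^sup>2 * \<Delta>)"
    unfolding D'[symmetric] by algebra
  also have "\<dots> = - t\<^sup>2 * (T\<^sup>2 * \<Delta>) + t\<^sup>2 * T\<^sup>2 + \<beta> * T * (1 + t - t * (u - 1)) - t * (u - 1) * (1 + t) * \<beta>\<^sup>2"
    unfolding G' BT[symmetric] by algebra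
  also have "\<dots> = t\<^sup>2 * ?N"
    unfolding D unfolding T_def \<beta>_def by algebra
  finally show ?thesis using nz by simp
qed

theorem theorem5p1:
  shows "fibrun_gf indet_u indet_d =
    (let u = fps_const indet_u; d = fps_const indet_d; t = fps_X;
         N = (d + u) * t - d * (u - 2) * t^2 + (d^2 - d - 2 * u) * t^3
             - (d - 2) * d * (u - 2) * t^4
             - (d - 1) * (u - d + d * u) * t^5 - d * (d + u - 2) * t^6
             + d * (1 - 2 * d + 2 * d^2 + d * u - 2 * d^2 * u) * t^7
             - 2 * (d - 1) * d^2 * (u - 1) * t^8
             - (d - 1) * d^2 * (d + 1) * (u - 1) * t^9
             - (d - 1)^2 * d^2 * (u - 1) * t^10
             - (d - 1)^2 * d^2 * (u - 1) * t^11;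
         D = 1 - u * t - 2 * t^2 + (2 * u - d) * t^3 + t^4
             + (2 * d - d^2 - u) * t^5 + d * (d * u - 1) * t^7
             + 2 * (d - 1) * d^2 * (u - 1) * t^9
             + (d - 1)^2 * d^2 * (u - 1) * t^11
     in N / D)"
proof -
  let ?u = "fps_const indet_u" and ?d = "fps_const indet_d" and ?t = "fps_X :: ratfun_ud fps"
  let ?B = "block_gf indet_d" and ?W = "code_gf2 indet_u indet_d"
  \<comment> \<open>a triple \<open>x, 0, z\<close> counts iff \<open>z = 0\<close>, whatever \<open>x\<close> is\<close>
  have W10: "?W 1 0 = ?W 0 0"
    by (subst (1 2) code_gf2_rec) simp
  have B0: "fps_nth ?B 0 = 0" by (simp add: block_gf_def)
  then have "fps_nth (1 - ?B) 0 \<noteq> 0" by simp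
  then have nz: "1 - ?B \<noteq> 0" by (metis fps_zero_nth)
  note eq = transfer_system_solution
    [where t = ?t and u = ?u and d = ?d and B = ?B and P = "?W 0 0" and Q = "?W 0 1" and R = "?W 1 1"
      and Y = "code_gf1 indet_u indet_d 0" and G = "fibrun_gf indet_u indet_d"
      and S = "code_gf (\<lambda>s. indet_u ^ up_triples s * indet_d ^ down_moves s)"]
  have main: "fibrun_gf indet_u indet_d * (1 - ?u * ?t - 2 * ?t^2 + (2 * ?u - ?d) * ?t^3 + ?t^4
             + (2 * ?d - ?d^2 - ?u) * ?t^5 + ?d * (?d * ?u - 1) * ?t^7
             + 2 * (?d - 1) * ?d^2 * (?u - 1) * ?t^9
             + (?d - 1)^2 * ?d^2 * (?u - 1) * ?t^11)
       = (?d + ?u) * ?t - ?d * (?u - 2) * ?t^2 + (?d^2 - ?d - 2 * ?u) * ?t^3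
             - (?d - 2) * ?d * (?u - 2) * ?t^4
             - (?d - 1) * (?u - ?d + ?d * ?u) * ?t^5 - ?d * (?d + ?u - 2) * ?t^6
             + ?d * (1 - 2 * ?d + 2 * ?d^2 + ?d * ?u - 2 * ?d^2 * ?u) * ?t^7
             - 2 * (?d - 1) * ?d^2 * (?u - 1) * ?t^8
             - (?d - 1) * ?d^2 * (?d + 1) * (?u - 1) * ?t^9
             - (?d - 1)^2 * ?d^2 * (?u - 1) * ?t^10
             - (?d - 1)^2 * ?d^2 * (?u - 1) * ?t^11" (is "_ * ?D = ?N")
  proof (rule eq)
    show "?W 0 0 = 1 + ?u * ?t * ?W 0 0 + ?B * ?W 0 1"
      using code_gf2_rec[of indet_u indet_d 0 0] by simp
    show "?W 0 1 = 1 + ?u * ?t * ?W 0 0 + ?B * ?W 1 1"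
      using code_gf2_rec[of indet_u indet_d 0 1] W10 by simp
    show "?W 1 1 = 1 + ?t * ?W 0 0 + ?B * ?W 1 1"
      using code_gf2_rec[of indet_u indet_d 1 1] W10 by simp
    show "code_gf1 indet_u indet_d 0 = 1 + ?t * ?W 0 0 + ?B * ?W 0 1"
      using code_gf1_rec[of indet_u indet_d 0] by simp
    \<comment> \<open>After one positive entry, as after two, the next entry earns no
      \<open>u\<close>, so both series have the same right-hand side.\<close>
    have "code_gf1 indet_u indet_d 1 = ?W 1 1"
      using code_gf1_rec[of indet_u indet_d 1] code_gf2_rec[of indet_u indet_d 1 1] by simp
    then show "code_gf (\<lambda>s. indet_u ^ up_triples s * indet_d ^ down_moves s)
        = 1 + ?t * code_gf1 indet_u indet_d 0 + ?B * ?W 1 1"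
      using code_gf_weight_rec[of indet_u indet_d] by simp
    show "?B * (1 - ?t\<^sup>2) = ?d * ?t ^ 3 + (?d\<^sup>2 - ?d) * ?t ^ 5"
      using block_gf_mult[of indet_d] by (simp add: fps_const_power)
  qed (use nz code_gf_weight_eq_fibrun_gf in auto)
  \<comment> \<open>The constant term 1 makes the denominator nonzero, so the quotient of series is
    exact.\<close>
  have "fps_nth ?D 0 = 1" by simp
  then have "?D \<noteq> 0" by (metis fps_zero_nth zero_neq_one)
  then have "?N div ?D = fibrun_gf indet_u indet_d"
    unfolding main[symmetric] by (rule nonzero_mult_div_cancel_right)
  then show ?thesis unfolding Let_def by simp
qed

end
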